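(* Let $n = 2m$ be an even positive integer and let $C$ be a Coxeter element in the symmetric group $\mathfrak{S}_{2m}$. Then $C^m$ is the longest word (longest element) in $\mathfrak{S}_{2m}$ if and only if the standard Amida diagram of $C$ is symmetric with respect to the vertical axis between the $m$-th and the $(m+1)$-st vertical lines.
   Context: $\mathfrak{S}_n$ is the symmetric group on $\{1,\dots,n\}$ with generators $s_i=(i,i+1)$, $1\le i\le n-1$; products of permutations are composed from right to left. The length $\ell(w)$ is the minimal number of generators in an expression of $w$; the longest element $w_0\in\mathfrak{S}_n$ is the unique element of length $n(n-1)/2$, given by $w_0(i)=n+1-i$. A Coxeter element of $\mathfrak{S}_n$ is a product of the $n-1$ distinct generators $s_1,\dots,s_{n-1}$, each used exactly once, in some order. Standard Amida diagram of a Coxeter element $C$: draw $n$ vertical lines numbered $1,\dots,n$ from left to right, and for each $i$ exactly one horizontal segment (the $i$-th segment, representing $s_i$) joining the $i$-th and $(i+1)$-st vertical lines; for $2\le i\le n-1$ the $i$-th segment is placed higher than the $(i-1)$-st segment if $s_i$ occurs to the left of $s_{i-1}$ in the product expressing $C$, and lower if $s_i$ occurs to the right of $s_{i-1}$. The diagram is considered up to isotopy, i.e. only the relative heights of consecutive segments matter. It is thus encoded by the sign sequence $[\epsilon_2,\dots,\epsilon_{n-1}]$, where $\epsilon_i=+1$ (resp. $-1$) if the $i$-th segment is higher (resp. lower) than the $(i-1)$-st one; this sequence depends only on $C$. Reflection in the vertical axis sends the $i$-th segment to the $(n-i)$-th position without changing heights, so for $n=2m$ the diagram is symmetric with respect to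 the axis between lines $m$ and $m+1$ exactly when $\epsilon_{n+1-i}=-\epsilon_i$ for all $2\le i\le n-1$. *)

theory Defs
  imports Complex_Main "HOL-Combinatorics.Permutations"
begin

text \<open>Elements of the symmetric group on \<open>{1..n}\<close> are functions \<open>w :: nat \<Rightarrow> nat\<close> with
  \<open>w permutes {1..n}\<close> (identity outside \<open>{1..n}\<close>). A word in the generators is the list of the
  indices of its letters, the leftmost letter first; since products are composed from right to
  left, the last letter acts first.\<close>

definition simple_gen :: "nat \<Rightarrow> nat \<Rightarrow> nat" where
  "simple_gen i = transpose i (Suc i)"

definition word_prod :: "nat list \<Rightarrow> nat \<Rightarrow> nat" where
  "word_prod ws = foldr (\<lambda>i f. simple_gen i \<circ> f) ws id"

definition perm_length :: "nat \<Rightarrow> (nat \<Rightarrow> nat) \<Rightarrow> nat" where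
  "perm_length n w = (LEAST k. \<exists>ws. set ws \<subseteq> {1..n-1} \<and> length ws = k \<and> word_prod ws = w)"

definition is_longest_element :: "nat \<Rightarrow> (nat \<Rightarrow> nat) \<Rightarrow> bool" where
  "is_longest_element n w \<longleftrightarrow> w permutes {1..n} \<and> perm_length n w = n * (n - 1) div 2"

definition coxeter_word :: "nat \<Rightarrow> nat list \<Rightarrow> bool" where
  "coxeter_word n ws \<longleftrightarrow> distinct ws \<and> set ws = {1..n-1}"

definition coxeter_element :: "nat \<Rightarrow> (nat \<Rightarrow> nat) \<Rightarrow> bool" where
  "coxeter_element n C \<longleftrightarrow> (\<exists>ws. coxeter_word n ws \<and> C = word_prod ws)"

definition occurs_left_of :: "nat list \<Rightarrow> nat \<Rightarrow> nat \<Rightarrow> bool" where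
  "occurs_left_of ws i j \<longleftrightarrow> (\<exists>a b. a < b \<and> b < length ws \<and> ws ! a = i \<and> ws ! b = j)"

text \<open>An Amida diagram on \<open>n\<close> vertical lines with exactly one horizontal segment between any two
  adjacent lines is given by the heights \<open>h i\<close> of its segments, \<open>1 \<le> i \<le> n - 1\<close>; the values of
  \<open>h\<close> elsewhere are irrelevant. Up to isotopy it is determined by its sign sequence.\<close>

type_synonym amida = "nat \<Rightarrow> real"

definition amida_sign :: "amida \<Rightarrow> nat \<Rightarrow> real" where
  "amida_sign h i = sgn (h i - h (i - 1))"

definition amida_isotopic :: "nat \<Rightarrow> amida \<Rightarrow> amida \<Rightarrow> bool" where
  "amida_isotopic n h h' \<longleftrightarrow> (\<forall>i\<in>{2..n-1}. amida_sign h i = amida_sign h' i)"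

text \<open>Reflection in the vertical axis halfway between the lines \<open>1\<close> and \<open>n\<close>; for \<open>n = 2 * m\<close> this
  is the axis between the lines \<open>m\<close> and \<open>m + 1\<close>.\<close>

definition amida_reflect :: "nat \<Rightarrow> amida \<Rightarrow> amida" where
  "amida_reflect n h = (\<lambda>i. h (n - i))"

definition amida_symmetric :: "nat \<Rightarrow> amida \<Rightarrow> bool" where
  "amida_symmetric n h \<longleftrightarrow> amida_isotopic n (amida_reflect n h) h"

definition word_amida :: "nat \<Rightarrow> nat list \<Rightarrow> amida \<Rightarrow> bool" where
  "word_amida n ws h \<longleftrightarrow>
     (\<forall>i\<in>{2..n-1}. (occurs_left_of ws i (i - 1) \<longrightarrow> h i > h (i - 1)) \<and>
                   (occurs_left_of ws (i - 1) i \<longrightarrow> h i < h (i - 1)))"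

text \<open>The diagram is only determined up to isotopy, so being the standard diagram of \<open>C\<close> is a
  relation between \<open>C\<close> and representatives \<open>h\<close>.\<close>

definition standard_amida :: "nat \<Rightarrow> (nat \<Rightarrow> nat) \<Rightarrow> amida \<Rightarrow> bool" where
  "standard_amida n C h \<longleftrightarrow> (\<exists>ws. coxeter_word n ws \<and> C = word_prod ws \<and> word_amida n ws h)"

lemma amida_symmetric_iff_signs:
  "amida_symmetric n h \<longleftrightarrow> (\<forall>i\<in>{2..n-1}. amida_sign h (n + 1 - i) = - amida_sign h i)"
proof -
  have "amida_sign (amida_reflect n h) i = - amida_sign h (n + 1 - i)" if "i \<in> {2..n-1}" for i
  proof -
    have "n + 1 - i - 1 = n - i" "n - (i - 1) = n + 1 - i" using that by auto
    then show ?thesis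
      by (simp add: amida_sign_def amida_reflect_def flip: sgn_minus)
  qed
  then show ?thesis
    unfolding amida_symmetric_def amida_isotopic_def by (metis minus_minus)
qed

lemma standard_amida_exists:
  assumes "coxeter_element n C"
  shows "\<exists>h. standard_amida n C h"
proof -
  from assms obtain ws where ws: "coxeter_word n ws" "C = word_prod ws"
    by (auto simp: coxeter_element_def)
  define pos where "pos i = (THE a. a < length ws \<and> ws ! a = i)" for i
  have pos: "pos (ws ! a) = a" if "a < length ws" for a
    unfolding pos_def using that ws(1)
    by (intro the_equality) (auto simp: coxeter_word_def nth_eq_iff_index_eq)
  have "word_amida n ws (\<lambda>i. - real (pos i))"
    by (auto simp: word_amida_def occurs_left_of_def) (metis pos order.strict_trans)+
  with ws show ?thesis by (auto simp: standard_amida_def)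
qed

end

theory Submission imports Defs begin

text \<open>Conjugation by \<open>w\<^sub>0\<close> sends \<open>s\<^sub>i\<close> to \<open>s\<^bsub>n-i\<^esub>\<close>, so it reflects the diagram of \<open>C\<close>. The signs determine
  \<open>C\<close>, and conversely \<open>C i < i\<close> holds for \<open>1 < i < n\<close> exactly if the sign at \<open>i\<close> is positive. Hence the
  diagram is symmetric if and only if \<open>C\<close> commutes with \<open>w\<^sub>0\<close>. As \<open>C\<close> is an \<open>n\<close>-cycle, an element that
  commutes with it is a power of it, and the only power of order two is \<open>C\<^sup>m\<close>.\<close>

subsection \<open>Length and inversions\<close>

definition inversions :: "nat \<Rightarrow> (nat \<Rightarrow> nat) \<Rightarrow> (nat \<times> nat) set" where
  "inversions n w = {(i, j). 1 \<le> i \<and> i < j \<and> j \<le> n \<and> w j < w i}"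

text \<open>This is \<open>w\<^sub>0\<close>. Being the identity outside \<open>{1..n}\<close>, as
  \<open>permutes\<close> demands, it can be compared with other permutations as a function on all
  of \<open>nat\<close>.\<close>

definition rev_perm :: "nat \<Rightarrow> nat \<Rightarrow> nat" where
  "rev_perm n i = (if i \<in> {1..n} then n + 1 - i else i)"

lemma finite_inversions [simp]: "finite (inversions n w)"
  by (rule finite_subset[of _ "{1..n} \<times> {1..n}"]) (auto simp: inversions_def)

lemma simple_gen_simple_gen [simp]: "simple_gen i (simple_gen i x) = x"
  by (simp add: simple_gen_def)

lemma simple_gen_comp_simple_gen [simp]: "simple_gen i \<circ> simple_gen i = id"
  by (auto simp: fun_eq_iff)

lemma inj_simple_gen: "inj (simple_gen i)"
  by (metis injI simple_gen_simple_gen)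

lemma word_prod_Nil [simp]: "word_prod [] = id"
  by (simp add: word_prod_def)

lemma word_prod_Cons [simp]: "word_prod (i # ws) = simple_gen i \<circ> word_prod ws"
  by (simp add: word_prod_def)

lemma word_prod_append [simp]: "word_prod (us @ vs) = word_prod us \<circ> word_prod vs"
  by (induction us) (auto simp: o_assoc)

lemma simple_gen_permutes: "i \<in> {1..n-1} \<Longrightarrow> simple_gen i permutes {1..n}"
  unfolding simple_gen_def by (rule permutes_swap_id) auto

lemma word_prod_permutes: "set ws \<subseteq> {1..n-1} \<Longrightarrow> word_prod ws permutes {1..n}"
proof (induction ws)
  case (Cons i ws)
  then show ?case
    using permutes_compose[of "word_prod ws" "{1..n}" "simple_gen i"] simple_gen_permutes[of i n]
    by (simp add: comp_def)
qed (simp add: permutes_id)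

text \<open>The swap of positions \<open>i\<close> and \<open>Suc i\<close> keeps the order of every
  other pair of positions, so it carries the old inversions injectively to new ones; the pair
  \<open>(i, Suc i)\<close> itself is the one gained.\<close>

lemma card_inversions_ascent:
  assumes i: "i \<in> {1..n-1}" and asc: "w i < w (Suc i)"
  shows "card (inversions n (w \<circ> simple_gen i)) = Suc (card (inversions n w))"
proof -
  let ?s = "simple_gen i"
  have "inversions n (w \<circ> ?s) = insert (i, Suc i) (map_prod ?s ?s ` inversions n w)" (is "?L = ?R")
  proof (intro equalityI subsetI)
    fix p assume p: "p \<in> ?L"
    obtain a b where ab: "p = (a, b)" by fastforce
    show "p \<in> ?R"
    proof (cases "a = i \<and> b = Suc i")
      case False
      then have "(?s a, ?s b) \<in> inversions n w"
        using p i unfolding ab inversions_def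
        by (auto simp: simple_gen_def transpose_def split: if_splits)
      then have "map_prod ?s ?s (?s a, ?s b) \<in> map_prod ?s ?s ` inversions n w"
        by (rule imageI)
      then show ?thesis by (simp add: ab)
    qed (simp add: ab)
  next
    fix p assume p: "p \<in> ?R"
    show "p \<in> ?L"
    proof (cases "p = (i, Suc i)")
      case True
      then show ?thesis using i asc by (auto simp: inversions_def simple_gen_def)
    next
      case False
      then obtain a b where ab: "p = (?s a, ?s b)" "(a, b) \<in> inversions n w" using p by auto
      have "\<not> (a = i \<and> b = Suc i)" using ab(2) asc by (auto simp: inversions_def)
      then have "?s a < ?s b" "1 \<le> ?s a" "?s b \<le> n"
        using ab(2) i by (auto simp: inversions_def simple_gen_def transpose_def)
      then show ?thesis using ab by (simp add: inversions_def)
    qed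
  qed
  moreover have "(i, Suc i) \<notin> map_prod ?s ?s ` inversions n w"
  proof
    assume "(i, Suc i) \<in> map_prod ?s ?s ` inversions n w"
    then obtain a b where ab: "i = ?s a" "Suc i = ?s b" "a < b" by (auto simp: inversions_def)
    have "?s i = a" "?s (Suc i) = b"
      using arg_cong[OF ab(1), of ?s] arg_cong[OF ab(2), of ?s] by simp_all
    then show False using ab(3) by (simp add: simple_gen_def)
  qed
  moreover have "inj_on (map_prod ?s ?s) (inversions n w)"
    by (meson inj_on_subset inj_simple_gen prod.inj_map subset_UNIV)
  ultimately show ?thesis by (simp add: card_image)
qed

lemma card_inversions_descent:
  assumes "i \<in> {1..n-1}" and "w (Suc i) < w i"
  shows "card (inversions n w) = Suc (card (inversions n (w \<circ> simple_gen i)))"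
  using card_inversions_ascent[of i n "w \<circ> simple_gen i"] assms
  by (simp add: comp_assoc) (simp add: simple_gen_def)

text \<open>Each further letter on the right changes the number of inversions by exactly one, so a
  word cannot create more inversions than it has letters.\<close>

lemma card_inversions_le_length:
  "set ws \<subseteq> {1..n-1} \<Longrightarrow> card (inversions n (word_prod ws)) \<le> length ws"
proof (induction ws rule: rev_induct)
  case Nil
  have "inversions n (word_prod []) = {}" by (auto simp: inversions_def)
  then show ?case by (simp only: card.empty le0)
next
  case (snoc i ws)
  let ?w = "word_prod ws"
  have "inj ?w" using snoc.prems word_prod_permutes[of ws n] permutes_inj by auto
  then have "?w i \<noteq> ?w (Suc i)" by (metis injD n_not_Suc_n)
  then have "card (inversions n (?w \<circ> simple_gen i)) \<le> Suc (card (inversions n ?w))"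
    using card_inversions_ascent[of i n ?w] card_inversions_descent[of i n ?w] snoc.prems
    by (cases "?w i < ?w (Suc i)") auto
  then show ?case using snoc by (auto simp: comp_def)
qed

text \<open>Growth forces \<open>i \<le> w i\<close> everywhere, while both sides have the same sum
  over \<open>{1..n}\<close>; hence no inequality is strict.\<close>

lemma increasing_permutation_eq_id:
  assumes w: "w permutes {1..n}" and inc: "\<And>i. i \<in> {1..n-1} \<Longrightarrow> w i < w (Suc i)"
  shows "w = id"
proof -
  have ge: "i \<le> n \<Longrightarrow> i \<le> w i" for i
  proof (induction i)
    case (Suc i)
    show ?case
    proof (cases "i = 0")
      case True
      then show ?thesis using permutes_in_image[OF w, of "Suc i"] Suc.prems by simp
    next
      case False
      then show ?thesis using Suc inc[of i] by fastforce
    qed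
  qed simp
  have eq: "(\<Sum>i\<in>{1..n}. w i) = (\<Sum>i\<in>{1..n}. i)"
    using sum.permute[OF w, of id] by (simp add: comp_def)
  show ?thesis
  proof
    fix i show "w i = id i"
    proof (cases "i \<in> {1..n}")
      case True
      then show ?thesis using sum_mono_inv[of id "{1..n}" w i] eq ge by auto
    next
      case False
      then show ?thesis using permutes_not_in[OF w] by simp
    qed
  qed
qed

text \<open>Bubble sort: as long as there is an inversion there is an adjacent descent, and
  multiplying by its generator removes exactly one inversion.\<close>

lemma exists_word_of_length_card_inversions:
  "w permutes {1..n} \<Longrightarrow>
    \<exists>ws. set ws \<subseteq> {1..n-1} \<and> length ws = card (inversions n w) \<and> word_prod ws = w"
proof (induction "card (inversions n w)" arbitrary: w)
  case 0
  have "w = id"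
  proof (rule increasing_permutation_eq_id[OF "0.prems"])
    fix i assume i: "i \<in> {1..n-1}"
    have "inversions n w = {}" using 0 by simp
    then have "\<not> w (Suc i) < w i" using i by (auto simp: inversions_def)
    moreover have "w i \<noteq> w (Suc i)" by (metis "0.prems" injD n_not_Suc_n permutes_inj)
    ultimately show "w i < w (Suc i)" by simp
  qed
  then show ?case using 0 by (intro exI[of _ "[]"]) auto
next
  case (Suc k)
  have "\<exists>i\<in>{1..n-1}. w (Suc i) < w i"
  proof (rule ccontr)
    assume *: "\<not> ?thesis"
    have "w = id"
    proof (rule increasing_permutation_eq_id[OF Suc.prems])
      fix i assume "i \<in> {1..n-1}"
      moreover have "w i \<noteq> w (Suc i)" by (metis Suc.prems injD n_not_Suc_n permutes_inj)
      ultimately show "w i < w (Suc i)" using * by (meson linorder_neqE_nat)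
    qed
    then have "inversions n w = {}" by (auto simp: inversions_def)
    then show False using Suc.hyps(2) by simp
  qed
  then obtain i where i: "i \<in> {1..n-1}" "w (Suc i) < w i" by blast
  let ?v = "w \<circ> simple_gen i"
  have card: "card (inversions n w) = Suc (card (inversions n ?v))"
    using card_inversions_descent i by blast
  have "?v permutes {1..n}"
    using permutes_compose simple_gen_permutes i(1) Suc.prems by blast
  then obtain ws where ws: "set ws \<subseteq> {1..n-1}" "length ws = card (inversions n ?v)"
      "word_prod ws = ?v"
    using Suc.hyps card by (metis Suc_inject)
  have "word_prod (ws @ [i]) = w"
    using ws(3) by (simp add: comp_assoc)
  then show ?case using ws i card by (intro exI[of _ "ws @ [i]"]) auto
qed

lemma perm_length_eq_card_inversions:
  assumes "w permutes {1..n}"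
  shows "perm_length n w = card (inversions n w)"
  unfolding perm_length_def
proof (rule Least_equality)
  fix k assume "\<exists>ws. set ws \<subseteq> {1..n-1} \<and> length ws = k \<and> word_prod ws = w"
  then show "card (inversions n w) \<le> k" using card_inversions_le_length by blast
qed (use exists_word_of_length_card_inversions[OF assms] in simp)

section \<open>The reversal as the longest element\<close>

lemma rev_perm_rev_perm [simp]: "rev_perm n (rev_perm n i) = i"
  by (auto simp: rev_perm_def)

lemma rev_perm_comp_rev_perm [simp]: "rev_perm n \<circ> rev_perm n = id"
  by (simp add: fun_eq_iff)

lemma rev_perm_permutes: "rev_perm n permutes {1..n}"
proof (rule bij_imp_permutes)
  show "bij_betw (rev_perm n) {1..n} {1..n}"
    by (rule bij_betw_byWitness[where f' = "rev_perm n"]) (auto simp: rev_perm_def)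
qed (auto simp: rev_perm_def)

lemma card_pairs: "card {(i, j). 1 \<le> i \<and> i < j \<and> j \<le> (n::nat)} = n * (n - 1) div 2"
proof (induction n)
  case 0
  have "{(i, j). 1 \<le> i \<and> i < j \<and> j \<le> (0::nat)} = {}" by auto
  then show ?case by (simp only: card.empty)
next
  case (Suc n)
  let ?P = "\<lambda>n. {(i, j). 1 \<le> i \<and> i < j \<and> j \<le> (n::nat)}"
  have "?P (Suc n) = ?P n \<union> (\<lambda>i. (i, Suc n)) ` {1..n}" by auto
  moreover have "finite (?P n)" by (rule finite_subset[of _ "{1..n} \<times> {1..n}"]) auto
  moreover have "card ((\<lambda>i. (i, Suc n)) ` {1..n}) = n" by (simp add: card_image inj_on_def)
  ultimately have "card (?P (Suc n)) = card (?P n) + n"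
    by (simp only:) (subst card_Un_disjoint, auto)
  also have "\<dots> = (n * (n - 1) + 2 * n) div 2" unfolding Suc.IH by simp
  also have "n * (n - 1) + 2 * n = Suc n * (Suc n - 1)" by (cases n) auto
  finally show ?case .
qed

text \<open>The required length is the number of all pairs, so it is attained only if every pair is
  inverted, that is, if \<open>w\<close> is decreasing.\<close>

lemma is_longest_element_iff_rev_perm:
  assumes w: "w permutes {1..n}"
  shows "is_longest_element n w \<longleftrightarrow> w = rev_perm n"
proof -
  define P where "P = {(i, j). 1 \<le> i \<and> i < j \<and> j \<le> n}"
  have fin: "finite P" by (rule finite_subset[of _ "{1..n} \<times> {1..n}"]) (auto simp: P_def)
  have sub: "inversions n w \<subseteq> P" by (auto simp: inversions_def P_def)
  have "is_longest_element n w \<longleftrightarrow> card (inversions n w) = card P"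
    using w unfolding P_def card_pairs is_longest_element_def
    by (simp only: perm_length_eq_card_inversions simp_thms)
  also have "\<dots> \<longleftrightarrow> inversions n w = P"
    using card_subset_eq[OF fin sub] by (rule iffI) simp_all
  also have "\<dots> \<longleftrightarrow> w = rev_perm n"
  proof
    assume all: "inversions n w = P"
    \<comment> \<open>Reversing the values of a decreasing permutation makes it increasing, hence
      the identity.\<close>
    have "rev_perm n \<circ> w = id"
    proof (rule increasing_permutation_eq_id)
      show "rev_perm n \<circ> w permutes {1..n}"
        using permutes_compose[OF w rev_perm_permutes] .
      fix i assume i: "i \<in> {1..n-1}"
      then have "(i, Suc i) \<in> inversions n w" unfolding all P_def by auto
      then have "w (Suc i) < w i" by (auto simp: inversions_def)
      moreover have "w i \<in> {1..n}" "w (Suc i) \<in> {1..n}" unfolding permutes_in_image[OF w] using i by auto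
      ultimately show "(rev_perm n \<circ> w) i < (rev_perm n \<circ> w) (Suc i)"
        by (auto simp: rev_perm_def)
    qed
    then show "w = rev_perm n"
      by (metis comp_assoc comp_id id_comp rev_perm_comp_rev_perm)
  qed (auto simp: inversions_def rev_perm_def P_def)
  finally show ?thesis .
qed

subsection \<open>Relative position of letters\<close>

text \<open>In this form the relation can be followed through deletion and concatenation of lists
  without tracking indices.\<close>

lemma occurs_left_of_iff_split:
  "occurs_left_of ws i j \<longleftrightarrow> (\<exists>xs ys. ws = xs @ ys \<and> i \<in> set xs \<and> j \<in> set ys)"
proof
  assume "occurs_left_of ws i j"
  then obtain a b where ab: "a < b" "b < length ws" "ws ! a = i" "ws ! b = j"
    by (auto simp: occurs_left_of_def)
  have "i \<in> set (take b ws)" using ab by (auto simp: in_set_conv_nth)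
  moreover have "j \<in> set (drop b ws)"
    using ab by (metis Cons_nth_drop_Suc list.set_intros(1))
  ultimately show "\<exists>xs ys. ws = xs @ ys \<and> i \<in> set xs \<and> j \<in> set ys"
    by (metis append_take_drop_id)
next
  assume "\<exists>xs ys. ws = xs @ ys \<and> i \<in> set xs \<and> j \<in> set ys"
  then obtain xs ys a b where "ws = xs @ ys" "a < length xs" "xs ! a = i" "b < length ys" "ys ! b = j"
    by (auto simp: in_set_conv_nth)
  then show "occurs_left_of ws i j"
    unfolding occurs_left_of_def
    by (intro exI[of _ a] exI[of _ "length xs + b"]) (auto simp: nth_append)
qed

lemma occurs_left_of_flip:
  assumes "distinct ws" "i \<in> set ws" "j \<in> set ws" "i \<noteq> j"
  shows "occurs_left_of ws i j \<longleftrightarrow> \<not> occurs_left_of ws j i"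
proof -
  obtain a b where ab: "a < length ws" "ws ! a = i" "b < length ws" "ws ! b = j"
    using assms by (auto simp: in_set_conv_nth)
  have "c = a" if "c < length ws" "ws ! c = i" for c
    using that ab assms(1) nth_eq_iff_index_eq by blast
  moreover have "c = b" if "c < length ws" "ws ! c = j" for c
    using that ab assms(1) nth_eq_iff_index_eq by blast
  ultimately have "occurs_left_of ws i j \<longleftrightarrow> a < b" "occurs_left_of ws j i \<longleftrightarrow> b < a"
    unfolding occurs_left_of_def using ab by (blast intro: less_trans)+
  moreover have "a \<noteq> b" using ab assms(4) by auto
  ultimately show ?thesis by auto
qed

text \<open>Deleting from both halves of a split gives one direction. The other is the same
  implication for the swapped pair, since in either list exactly one of the two orders
  occurs.\<close>

lemma occurs_left_of_removeAll:
  assumes "distinct ws" "i \<in> set ws" "j \<in> set ws" "i \<noteq> j" "i \<noteq> k" "j \<noteq> k"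
  shows "occurs_left_of (removeAll k ws) i j \<longleftrightarrow> occurs_left_of ws i j"
proof -
  have imp: "occurs_left_of (removeAll k ws) x y"
    if "occurs_left_of ws x y" "x \<noteq> k" "y \<noteq> k" for x y
  proof -
    obtain xs ys where "ws = xs @ ys" "x \<in> set xs" "y \<in> set ys"
      using \<open>occurs_left_of ws x y\<close> unfolding occurs_left_of_iff_split by blast
    then show ?thesis unfolding occurs_left_of_iff_split using that
      by (intro exI[of _ "removeAll k xs"] exI[of _ "removeAll k ys"]) simp
  qed
  have "distinct (removeAll k ws)" using assms(1) by (simp add: distinct_removeAll)
  then show ?thesis
    using imp[of i j] imp[of j i] occurs_left_of_flip[of ws i j]
      occurs_left_of_flip[of "removeAll k ws" i j] assms by auto
qed

lemma occurs_left_of_map: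
  assumes "inj_on f (set ws)" "i \<in> set ws" "j \<in> set ws"
  shows "occurs_left_of (map f ws) (f i) (f j) \<longleftrightarrow> occurs_left_of ws i j"
proof -
  have eq: "map f ws ! a = f x \<longleftrightarrow> ws ! a = x" if "a < length ws" "x \<in> set ws" for a x
    using that assms(1) by (simp add: inj_on_eq_iff)
  have "a < b \<and> b < length (map f ws) \<and> map f ws ! a = f i \<and> map f ws ! b = f j \<longleftrightarrow>
      a < b \<and> b < length ws \<and> ws ! a = i \<and> ws ! b = j" for a b
    using eq[of a i] eq[of b j] assms(2,3) by auto
  then show ?thesis unfolding occurs_left_of_def by simp
qed

subsection \<open>Coxeter elements\<close>

text \<open>The Coxeter element in which, for every \<open>i\<close>, the letter \<open>i\<close> is to the left of \<open>i - 1\<close>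
  exactly if \<open>d i\<close>: since \<open>s\<^sub>n\<close> commutes with all smaller generators except the preceding one, it can
  be moved to one end of the word.\<close>

fun coxeter_of :: "(nat \<Rightarrow> bool) \<Rightarrow> nat \<Rightarrow> nat \<Rightarrow> nat" where
  "coxeter_of d 0 = id"
| "coxeter_of d (Suc 0) = id"
| "coxeter_of d (Suc (Suc k)) =
    (if d (Suc k) then simple_gen (Suc k) \<circ> coxeter_of d (Suc k)
     else coxeter_of d (Suc k) \<circ> simple_gen (Suc k))"

lemma coxeter_of_cong:
  "(\<And>i. i \<in> {2..n-1} \<Longrightarrow> d i = d' i) \<Longrightarrow> coxeter_of d n = coxeter_of d' n"
proof (induction n rule: induct_nat_012)
  case (ge2 k)
  \<comment> \<open>For \<open>k = 0\<close> the hypothesis does not reach the index 1, but both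
    branches are then \<open>simple_gen 1\<close>.\<close>
  show ?case
  proof (cases "k = 0")
    case True
    then show ?thesis by simp
  next
    case False
    then have "d (Suc k) = d' (Suc k)" using ge2.prems[of "Suc k"] by auto
    moreover have "coxeter_of d (Suc k) = coxeter_of d' (Suc k)"
      by (cases "d (Suc k)") (auto intro!: ge2)
    ultimately show ?thesis by (simp add: fun_eq_iff)
  qed
qed auto

lemma simple_gen_commute_word_prod:
  assumes "\<And>i. i \<in> set ws \<Longrightarrow> Suc i < k"
  shows "simple_gen k \<circ> word_prod ws = word_prod ws \<circ> simple_gen k"
  using assms
proof (induction ws)
  case (Cons i ws)
  have "simple_gen k \<circ> simple_gen i = simple_gen i \<circ> simple_gen k"
    using Cons.prems[of i] by (auto simp: fun_eq_iff simple_gen_def transpose_def)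
  then show ?case using Cons by (simp add: fun_eq_iff)
qed simp

text \<open>The largest letter is pulled to the end of the word on the side away from its only
  non-commuting neighbour, and induction handles the rest. Thus the product depends only on the
  relative order of consecutive letters.\<close>

lemma word_prod_eq_coxeter_of:
  "coxeter_word n ws \<Longrightarrow> word_prod ws = coxeter_of (\<lambda>i. occurs_left_of ws i (i - 1)) n"
proof (induction n arbitrary: ws rule: induct_nat_012)
  case (ge2 k)
  let ?N = "Suc k"
  have dist: "distinct ws" and set: "set ws = {1..?N}"
    using ge2.prems by (auto simp: coxeter_word_def)
  then have "?N \<in> set ws" by simp
  then obtain us vs where split: "ws = us @ ?N # vs" by (meson split_list)
  have rem: "removeAll ?N ws = us @ vs" using dist split by auto
  have setuv: "set (us @ vs) = {1..k}" unfolding rem[symmetric] set_removeAll set by auto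
  then have "coxeter_word ?N (us @ vs)" using dist split by (auto simp: coxeter_word_def)
  then have "word_prod (us @ vs) = coxeter_of (\<lambda>i. occurs_left_of (us @ vs) i (i - 1)) ?N"
    using ge2.IH(2) by blast
  also have "\<dots> = coxeter_of (\<lambda>i. occurs_left_of ws i (i - 1)) ?N"
  proof (rule coxeter_of_cong)
    fix i assume "i \<in> {2..?N - 1}"
    then show "occurs_left_of (us @ vs) i (i - 1) = occurs_left_of ws i (i - 1)"
      unfolding rem[symmetric] by (intro occurs_left_of_removeAll dist) (auto simp: set)
  qed
  finally have IH: "word_prod (us @ vs) = coxeter_of (\<lambda>i. occurs_left_of ws i (i - 1)) ?N" .
  show ?case
  proof (cases "occurs_left_of ws ?N k")
    case True
    \<comment> \<open>The letters left of \<open>?N\<close> are then all below \<open>k\<close>, so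
      \<open>?N\<close> can move past them to the front.\<close>
    have "k \<notin> set us"
    proof
      assume k: "k \<in> set us"
      then have "occurs_left_of ws k ?N" unfolding occurs_left_of_iff_split using split by force
      moreover have "k \<in> set ws" "?N \<in> set ws" using k split by auto
      ultimately show False using True occurs_left_of_flip[OF dist, of ?N k] by simp
    qed
    then have "simple_gen ?N \<circ> word_prod us = word_prod us \<circ> simple_gen ?N"
      using setuv by (intro simple_gen_commute_word_prod)
        (metis Un_iff atLeastAtMost_iff le_neq_implies_less not_less_eq set_append)
    then have "word_prod ws = simple_gen ?N \<circ> word_prod (us @ vs)" by (simp add: split o_assoc)
    then show ?thesis using True IH by simp
  next
    case False
    \<comment> \<open>Symmetrically, \<open>?N\<close> can move to the back.\<close>
    have "k \<notin> set vs"
    proof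
      assume "k \<in> set vs"
      then have "occurs_left_of ws ?N k" unfolding occurs_left_of_iff_split split
        by (intro exI[of _ "us @ [?N]"] exI[of _ vs]) auto
      then show False using False by simp
    qed
    then have "simple_gen ?N \<circ> word_prod vs = word_prod vs \<circ> simple_gen ?N"
      using setuv by (intro simple_gen_commute_word_prod)
        (metis Un_iff atLeastAtMost_iff le_neq_implies_less not_less_eq set_append)
    then have "word_prod ws = word_prod (us @ vs) \<circ> simple_gen ?N" by (simp add: split comp_assoc)
    then show ?thesis using False IH by simp
  qed
qed (auto simp: coxeter_word_def)

lemma coxeter_of_permutes: "coxeter_of d n permutes {1..n}"
proof (induction n rule: induct_nat_012)
  case (ge2 k)
  have "coxeter_of d (Suc k) permutes {1..Suc (Suc k)}"
    using ge2.IH(2) by (rule permutes_subset) auto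
  moreover have "simple_gen (Suc k) permutes {1..Suc (Suc k)}"
    by (rule simple_gen_permutes) auto
  ultimately show ?case by (auto intro: permutes_compose)
qed (auto simp: permutes_id)

section \<open>Recovering the signs from the action on points, and transitivity\<close>

text \<open>The factor on \<open>{1..n-1}\<close> fixes \<open>n\<close>, so the last generator is
  what moves \<open>n\<close> down to \<open>n - 1\<close>, either after that factor or before
  it.\<close>

lemma coxeter_of_top_less:
  assumes "2 \<le> n"
  shows "coxeter_of d n n < n"
proof -
  obtain k where n: "n = Suc (Suc k)" using assms by (metis add_2_eq_Suc le_Suc_ex)
  have P: "coxeter_of d (Suc k) permutes {1..Suc k}" by (rule coxeter_of_permutes)
  have "coxeter_of d (Suc k) n = n" using n by (intro permutes_not_in[OF P]) auto
  moreover have "coxeter_of d (Suc k) (Suc k) < n" using permutes_in_image[OF P, of "Suc k"] n by auto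
  ultimately show ?thesis by (simp add: n simple_gen_def)
qed

text \<open>This makes the sign sequence an invariant of the permutation. The sign is decided when
  the generator \<open>i\<close> enters; later generators can only exchange values, or arguments,
  larger than \<open>i\<close>.\<close>

lemma coxeter_of_less_iff:
  assumes "2 \<le> i" "i < n"
  shows "coxeter_of d n i < i \<longleftrightarrow> d i"
  using assms(2)
proof (induction n rule: induct_nat_012)
  case (ge2 k)
  let ?c = "coxeter_of d (Suc k)"
  have P: "?c permutes {1..Suc k}" by (rule coxeter_of_permutes)
  have le: "?c i \<le> Suc k" using permutes_in_image[OF P, of i] ge2.prems assms(1) by auto
  show ?case
  proof (cases "i = Suc k")
    case True
    have "?c (Suc i) = Suc i" using True by (intro permutes_not_in[OF P]) auto
    moreover have "?c i < i" using coxeter_of_top_less[of i d] assms True by simp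
    ultimately show ?thesis using True by (auto simp: simple_gen_def transpose_def)
  next
    case False
    then have "i < Suc k" using ge2.prems by simp
    then show ?thesis using ge2.IH(2) le by (auto simp: simple_gen_def transpose_def)
  qed
qed (use assms(1) in auto)

text \<open>This is the transitivity that makes a Coxeter element an \<open>n\<close>-cycle.
  Removing the top point from the cycle leaves the smaller Coxeter element, to which induction
  applies.\<close>

lemma coxeter_of_invariant_set:
  assumes "S \<subseteq> {1..n}" "S \<noteq> {}" "\<And>x. x \<in> S \<Longrightarrow> coxeter_of d n x \<in> S"
  shows "S = {1..n}"
  using assms
proof (induction n arbitrary: S rule: induct_nat_012)
  case (ge2 k)
  let ?N = "Suc k" and ?c = "coxeter_of d (Suc k)" and ?c' = "coxeter_of d (Suc (Suc k))"
  have P: "?c permutes {1..?N}" by (rule coxeter_of_permutes)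
  have insert_top: "{1..Suc ?N} = insert (Suc ?N) {1..?N}" by auto
  have fix_top: "?c (Suc ?N) = Suc ?N" by (rule permutes_not_in[OF P]) auto
  have inv: "?c' x \<in> S" if "x \<in> S" for x using ge2.prems that by blast
  have le: "?c x \<in> {1..?N}" if "x \<in> {1..?N}" for x using permutes_in_image[OF P] that by blast
  \<comment> \<open>The smaller element follows \<open>?c'\<close> except where \<open>?c'\<close>
    makes a detour through \<open>Suc ?N\<close>; there two applications of \<open>?c'\<close> give
    the same value.\<close>
  have down: "?c x \<in> S \<inter> {1..?N}" if x: "x \<in> S \<inter> {1..?N}" for x
  proof (cases "d ?N")
    case True
    then have *: "?c' y = simple_gen ?N (?c y)" for y by simp
    have "?c x \<in> S"
    proof (cases "?c x = ?N")
      case eq: True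
      then have "Suc ?N \<in> S" using inv[of x] x * by (simp add: simple_gen_def)
      then show ?thesis using inv[of "Suc ?N"] * eq fix_top by (simp add: simple_gen_def)
    next
      case False
      then have "?c' x = ?c x" using le[of x] x * by (auto simp: simple_gen_def transpose_def)
      then show ?thesis using inv[of x] x by auto
    qed
    then show ?thesis using le x by auto
  next
    case False
    then have *: "?c' y = ?c (simple_gen ?N y)" for y by simp
    have "?c x \<in> S"
    proof (cases "x = ?N")
      case eq: True
      then have "Suc ?N \<in> S" using inv[of x] x * fix_top by (simp add: simple_gen_def)
      then show ?thesis using inv[of "Suc ?N"] * eq by (simp add: simple_gen_def)
    next
      case False
      then have "?c' x = ?c x" using x * by (auto simp: simple_gen_def transpose_def)
      then show ?thesis using inv[of x] x by auto
    qed
    then show ?thesis using le x by auto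
  qed
  \<comment> \<open>Otherwise \<open>S\<close> would consist of the top point alone, which is not
    fixed.\<close>
  have "S \<inter> {1..?N} \<noteq> {}"
  proof
    assume "S \<inter> {1..?N} = {}"
    then have "S \<subseteq> {Suc ?N}" using ge2.prems(1) insert_top by blast
    then have "?c' (Suc ?N) = Suc ?N" using ge2.prems(2) inv by blast
    then show False using coxeter_of_top_less[of "Suc ?N" d] by simp
  qed
  then have eq: "S \<inter> {1..?N} = {1..?N}" using ge2.IH(2)[of "S \<inter> {1..?N}"] down by blast
  \<comment> \<open>The preimage of the top point is not the top point, so it already lies in
    \<open>S\<close>.\<close>
  have "Suc ?N \<in> S"
  proof -
    have "?c' permutes {1..Suc ?N}" by (rule coxeter_of_permutes)
    then have "?c' ` {1..Suc ?N} = {1..Suc ?N}" by (rule permutes_image)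
    then have "Suc ?N \<in> ?c' ` {1..Suc ?N}" unfolding insert_top by (simp only: insertI1)
    then obtain x where x: "x \<in> {1..Suc ?N}" "?c' x = Suc ?N" by (metis imageE)
    then have "x \<noteq> Suc ?N" using coxeter_of_top_less[of "Suc ?N" d] by auto
    then have "x \<in> S" using x(1) eq insert_top by blast
    then show ?thesis using inv[of x] x(2) by simp
  qed
  moreover have "{1..?N} \<subseteq> S" using eq by (rule iffD2[OF inf.absorb_iff2])
  ultimately have "{1..Suc ?N} \<subseteq> S" unfolding insert_top by (simp only: insert_subset simp_thms)
  then show ?case using ge2.prems(1) by (rule equalityI[rotated])
qed auto

section \<open>Reflecting words by conjugation with the reversal\<close>

lemma simple_gen_reflect:
  assumes "i \<in> {1..n-1}"
  shows "simple_gen (n - i) = rev_perm n \<circ> simple_gen i \<circ> rev_perm n"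
proof -
  let ?r = "rev_perm n"
  have "?r i = Suc (n - i)" "?r (Suc i) = n - i" using assms by (auto simp: rev_perm_def)
  moreover have "transpose (?r (Suc i)) (?r i) x = ?r (transpose i (Suc i) (?r x))" for x
    unfolding transpose_def by (metis rev_perm_rev_perm)
  ultimately show ?thesis by (simp add: simple_gen_def fun_eq_iff)
qed

lemma word_prod_reflect:
  "set ws \<subseteq> {1..n-1} \<Longrightarrow>
    word_prod (map (\<lambda>i. n - i) ws) = rev_perm n \<circ> word_prod ws \<circ> rev_perm n"
proof (induction ws)
  case (Cons i ws)
  then show ?case using simple_gen_reflect[of i n] by (simp add: fun_eq_iff)
qed simp

lemma coxeter_word_reflect:
  assumes "coxeter_word n ws"
  shows "coxeter_word n (map (\<lambda>i. n - i) ws)"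
proof -
  have "inj_on (\<lambda>i. n - i) {1..n-1}" by (auto simp: inj_on_def)
  moreover have "(\<lambda>i. n - i) ` {1..n-1} = {1..n-1}"
  proof (intro equalityI subsetI)
    fix x assume "x \<in> {1..n-1}"
    then show "x \<in> (\<lambda>i. n - i) ` {1..n-1}" by (intro image_eqI[of _ _ "n - x"]) auto
  qed auto
  ultimately show ?thesis using assms by (auto simp: coxeter_word_def distinct_map)
qed

subsection \<open>The power of a Coxeter element\<close>

text \<open>Write \<open>r a\<close> as the \<open>k\<close>-th iterate of \<open>c\<close> at
  \<open>a\<close>. Commutation spreads this to the whole orbit, and as \<open>r\<close> is an
  involution moving \<open>a\<close>, \<open>2 * k\<close> is a multiple of the period
  \<open>2 * m\<close> with \<open>0 < k < 2 * m\<close>, which leaves \<open>k = m\<close>.\<close>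

lemma cycle_funpow_half_eq_involution:
  fixes c r :: "'a \<Rightarrow> 'a"
  assumes "m > 0" and card: "card A = 2 * m"
    and orbit: "A = range (\<lambda>k. (c ^^ k) a)"
    and comm: "c \<circ> r = r \<circ> c"
    and r: "r ` A \<subseteq> A" "\<And>x. x \<in> A \<Longrightarrow> r (r x) = x" "r a \<noteq> a"
    and inj: "inj c"
    and x: "x \<in> A"
  shows "(c ^^ m) x = r x"
proof -
  have fin: "finite A" using assms(1,2) card.infinite by fastforce
  have a: "a \<in> A" unfolding orbit by (metis funpow_0 rangeI)
  have injp: "inj (c ^^ k)" for k using inj by (rule inj_fn)
  have comm': "(c ^^ k) (r x) = r ((c ^^ k) x)" for k x
    using comm by (induction k) (auto simp: fun_eq_iff)
  have mod: "(c ^^ (j mod p)) a = (c ^^ j) a" if "(c ^^ p) a = a" for j p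
    using that by (rule funpow_mod_eq)
  \<comment> \<open>A return after \<open>p\<close> steps means that \<open>p\<close> points already
    fill the orbit.\<close>
  have period_ge: "2 * m \<le> p" if "p > 0" "(c ^^ p) a = a" for p
  proof -
    have "A \<subseteq> (\<lambda>k. (c ^^ k) a) ` {..<p}"
      unfolding orbit using mod[OF that(2)] that(1)
      by (metis (no_types, lifting) image_eqI image_subsetI lessThan_iff mod_less_divisor)
    then show ?thesis using card surj_card_le[of "{..<p}" A "\<lambda>k. (c ^^ k) a"] by simp
  qed
  \<comment> \<open>Pigeonhole on \<open>2 * m + 1\<close> iterates yields a return within
    \<open>2 * m\<close> steps, so the period is exactly \<open>2 * m\<close>.\<close>
  have "\<not> inj_on (\<lambda>k. (c ^^ k) a) {..2 * m}"
  proof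
    assume "inj_on (\<lambda>k. (c ^^ k) a) {..2 * m}"
    then have "card {..2 * m} \<le> card A" using fin orbit by (intro card_inj_on_le) auto
    then show False using card by simp
  qed
  then obtain i j where ij: "i < j" "j \<le> 2 * m" "(c ^^ i) a = (c ^^ j) a"
    unfolding inj_on_def by (metis atMost_iff linorder_neqE_nat)
  then have "(c ^^ i) ((c ^^ (j - i)) a) = (c ^^ i) a"
    by (metis add_diff_inverse_nat funpow_add less_imp_not_less o_apply)
  then have "(c ^^ (j - i)) a = a" using injp[of i] by (simp add: inj_eq)
  moreover from this have "j - i = 2 * m" using period_ge[of "j - i"] ij by simp
  ultimately have per: "(c ^^ (2 * m)) a = a" by simp
  obtain k0 where "r a = (c ^^ k0) a" using a r(1) unfolding orbit by blast
  then obtain k where k: "r a = (c ^^ k) a" "k < 2 * m"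
    using mod[OF per, of k0] assms(1) by (metis mod_less_divisor nat_0_less_mult_iff zero_less_numeral)
  have "(c ^^ (k + k)) a = r (r a)" by (simp add: funpow_add k(1)[symmetric] comm')
  then have kk: "(c ^^ (k + k)) a = a" using r(2) a by simp
  have "k \<noteq> 0" using k(1) r(3) by (intro notI) simp
  \<comment> \<open>A nonzero remainder would be a return time smaller than the period.\<close>
  moreover have "(c ^^ ((k + k) mod (2 * m))) a = a" using mod[OF per] kk by metis
  ultimately have "(k + k) mod (2 * m) = 0"
    using period_ge[of "(k + k) mod (2 * m)"] assms(1)
    by (metis gr0I leD mod_less_divisor nat_0_less_mult_iff zero_less_numeral)
  then have "2 * m dvd 2 * k" by (simp add: mod_eq_0_iff_dvd mult_2)
  then have "m dvd k" by simp
  then obtain q where q: "k = m * q" by blast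
  then have "q = 1" using k(2) \<open>k \<noteq> 0\<close> assms(1) by (cases q) auto
  then have "k = m" using q by simp
  moreover obtain l where "x = (c ^^ l) a" using x orbit by blast
  moreover have "(c ^^ m) ((c ^^ l) a) = (c ^^ l) ((c ^^ m) a)"
    by (metis add.commute funpow_add o_apply)
  ultimately show ?thesis using k(1) comm'[of l a] by simp
qed

lemma permutes_funpow: "p permutes A \<Longrightarrow> p ^^ k permutes A"
proof (induction k)
  case (Suc k)
  then show ?case using permutes_compose[of "p ^^ k" A p] by (simp add: comp_def)
qed (use permutes_id in \<open>simp add: id_def\<close>)

text \<open>A power of an element commutes with it. Conversely, the orbit of 1 is all of
  \<open>{1..n}\<close>, and the reversal is an involution moving 1 to \<open>n\<close>, so the
  statement on cycles applies.\<close>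

lemma coxeter_of_funpow_eq_rev_perm_iff:
  assumes "m > 0" and n: "n = 2 * m"
  shows "coxeter_of d n ^^ m = rev_perm n \<longleftrightarrow>
    coxeter_of d n \<circ> rev_perm n = rev_perm n \<circ> coxeter_of d n"
proof
  assume "coxeter_of d n ^^ m = rev_perm n"
  then show "coxeter_of d n \<circ> rev_perm n = rev_perm n \<circ> coxeter_of d n"
    by (metis funpow_Suc_right funpow.simps(2))
next
  assume comm: "coxeter_of d n \<circ> rev_perm n = rev_perm n \<circ> coxeter_of d n"
  let ?c = "coxeter_of d n"
  have P: "?c permutes {1..n}" by (rule coxeter_of_permutes)
  have Pk: "?c ^^ k permutes {1..n}" for k using P by (rule permutes_funpow)
  have one: "1 \<in> {1..n}" using assms by simp
  have orbit: "range (\<lambda>k. (?c ^^ k) 1) = {1..n}"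
  proof (rule coxeter_of_invariant_set)
    show "range (\<lambda>k. (?c ^^ k) 1) \<subseteq> {1..n}" by (auto simp only: permutes_in_image[OF Pk] one)
    show "?c x \<in> range (\<lambda>k. (?c ^^ k) 1)" if "x \<in> range (\<lambda>k. (?c ^^ k) 1)" for x
      using that by (auto intro: range_eqI[of _ _ "Suc _"])
  qed auto
  have "rev_perm n ` {1..n} \<subseteq> {1..n}" "rev_perm n 1 \<noteq> 1" using assms by (auto simp: rev_perm_def)
  then have half: "(?c ^^ m) x = rev_perm n x" if "x \<in> {1..n}" for x
    using that assms(1) orbit comm permutes_inj[OF P]
    by (intro cycle_funpow_half_eq_involution[where A = "{1..n}" and a = 1]) (simp_all add: n)
  show "?c ^^ m = rev_perm n"
  proof
    fix x show "(?c ^^ m) x = rev_perm n x"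
      using half permutes_not_in[OF Pk] permutes_not_in[OF rev_perm_permutes]
      by (cases "x \<in> {1..n}") auto
  qed
qed

section \<open>Commutation with the reversal as symmetry of the diagram\<close>

text \<open>To commute with the involution \<open>rev_perm n\<close> is to equal the conjugate by
  it, which is the product of the reflected word; two Coxeter elements are equal exactly if their
  sign sequences are.\<close>

lemma word_prod_commutes_rev_perm_iff:
  assumes ws: "coxeter_word n ws"
  shows "word_prod ws \<circ> rev_perm n = rev_perm n \<circ> word_prod ws \<longleftrightarrow>
    (\<forall>i\<in>{2..n-1}. occurs_left_of ws (n + 1 - i) (n - i) \<longleftrightarrow> \<not> occurs_left_of ws i (i - 1))"
    (is "?comm \<longleftrightarrow> ?anti")
proof -
  let ?us = "map (\<lambda>i. n - i) ws"
  let ?d = "\<lambda>ws i. occurs_left_of ws i (i - 1)"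
  have dist: "distinct ws" and set: "set ws = {1..n-1}" using ws by (auto simp: coxeter_word_def)
  have us: "coxeter_word n ?us" using ws by (rule coxeter_word_reflect)
  have "?comm \<longleftrightarrow> word_prod ws = rev_perm n \<circ> word_prod ws \<circ> rev_perm n"
    by (metis comp_assoc comp_id rev_perm_comp_rev_perm)
  also have "\<dots> \<longleftrightarrow> word_prod ws = word_prod ?us" using word_prod_reflect set by simp
  also have "\<dots> \<longleftrightarrow> coxeter_of (?d ws) n = coxeter_of (?d ?us) n"
    using word_prod_eq_coxeter_of[OF ws] word_prod_eq_coxeter_of[OF us] by simp
  also have "\<dots> \<longleftrightarrow> (\<forall>i\<in>{2..n-1}. ?d ws i = ?d ?us i)"
  proof
    assume eq: "coxeter_of (?d ws) n = coxeter_of (?d ?us) n"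
    show "\<forall>i\<in>{2..n-1}. ?d ws i = ?d ?us i"
    proof
      fix i assume "i \<in> {2..n-1}"
      then have "2 \<le> i" "i < n" by auto
      then show "?d ws i = ?d ?us i"
        using coxeter_of_less_iff[of i n "?d ws"] coxeter_of_less_iff[of i n "?d ?us"] eq by simp
    qed
  qed (auto intro: coxeter_of_cong)
  also have "\<dots> \<longleftrightarrow> ?anti"
  proof (rule ball_cong[OF refl])
    fix i assume i: "i \<in> {2..n-1}"
    \<comment> \<open>The letters \<open>i\<close> and \<open>i - 1\<close> of the reflected word
      come from \<open>n - i\<close> and \<open>n + 1 - i\<close>: the larger letter comes from the
      smaller one, which is where the negation arises.\<close>
    have "inj_on (\<lambda>i. n - i) (set ws)" unfolding set by (auto simp: inj_on_def)
    then have "occurs_left_of ?us (n - (n - i)) (n - (n + 1 - i)) \<longleftrightarrow>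
        occurs_left_of ws (n - i) (n + 1 - i)"
      by (rule occurs_left_of_map) (use i set in auto)
    moreover have "n - (n - i) = i" "n - (n + 1 - i) = i - 1" using i by auto
    moreover have "occurs_left_of ws (n + 1 - i) (n - i) \<longleftrightarrow> \<not> occurs_left_of ws (n - i) (n + 1 - i)"
      by (rule occurs_left_of_flip[OF dist]) (use i set in auto)
    ultimately show "?d ws i = ?d ?us i \<longleftrightarrow>
        (occurs_left_of ws (n + 1 - i) (n - i) \<longleftrightarrow> \<not> ?d ws i)" by auto
  qed
  finally show ?thesis .
qed

text \<open>One of the two orders always occurs, so no sign is 0 and negating a sign amounts to
  negating the order relation.\<close>

lemma amida_symmetric_iff_occurs_left_of:
  assumes ws: "coxeter_word n ws" and h: "word_amida n ws h"
  shows "amida_symmetric n h \<longleftrightarrow>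
    (\<forall>i\<in>{2..n-1}. occurs_left_of ws (n + 1 - i) (n - i) \<longleftrightarrow> \<not> occurs_left_of ws i (i - 1))"
proof -
  have sign: "amida_sign h i = (if occurs_left_of ws i (i - 1) then 1 else - 1)"
    if i: "i \<in> {2..n-1}" for i
  proof -
    have "occurs_left_of ws i (i - 1) \<longleftrightarrow> \<not> occurs_left_of ws (i - 1) i"
      by (rule occurs_left_of_flip) (use ws i in \<open>auto simp: coxeter_word_def\<close>)
    then show ?thesis using h i by (auto simp: word_amida_def amida_sign_def)
  qed
  show ?thesis unfolding amida_symmetric_iff_signs
  proof (rule ball_cong[OF refl])
    fix i assume i: "i \<in> {2..n-1}"
    then have "n + 1 - i \<in> {2..n-1}" "n + 1 - i - 1 = n - i" by auto
    then show "amida_sign h (n + 1 - i) = - amida_sign h i \<longleftrightarrow>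
        (occurs_left_of ws (n + 1 - i) (n - i) \<longleftrightarrow> \<not> occurs_left_of ws i (i - 1))"
      using sign[of i] sign[of "n + 1 - i"] i by auto
  qed
qed

theorem mainTheorem1:
  fixes m n :: nat and C :: "nat \<Rightarrow> nat" and h :: amida
  assumes "m > 0" and "n = 2 * m"
    and "coxeter_element n C"
    and "standard_amida n C h"
  shows "is_longest_element n (C ^^ m) \<longleftrightarrow> amida_symmetric n h"
proof -
  \<comment> \<open>The word is taken from the diagram, so that one word describes both
    \<open>C\<close> and the signs of \<open>h\<close>.\<close>
  obtain ws where ws: "coxeter_word n ws" "C = word_prod ws" "word_amida n ws h"
    using assms(4) by (auto simp: standard_amida_def)
  define d where "d = (\<lambda>i. occurs_left_of ws i (i - 1))"
  have C: "C = coxeter_of d n" using word_prod_eq_coxeter_of ws by (simp add: d_def)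
  have "C ^^ k permutes {1..n}" for k
    unfolding C using coxeter_of_permutes by (rule permutes_funpow)
  then have "is_longest_element n (C ^^ m) \<longleftrightarrow> C ^^ m = rev_perm n"
    by (rule is_longest_element_iff_rev_perm)
  also have "\<dots> \<longleftrightarrow> C \<circ> rev_perm n = rev_perm n \<circ> C"
    unfolding C using assms(1,2) by (rule coxeter_of_funpow_eq_rev_perm_iff)
  also have "\<dots> \<longleftrightarrow> amida_symmetric n h"
    using word_prod_commutes_rev_perm_iff[OF ws(1)] amida_symmetric_iff_occurs_left_of[OF ws(1,3)]
      ws(2) by simp
  finally show ?thesis .
qed

end
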